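(* Fix $\alpha>0$. Let $K$ be a random variable with values in $\{1,2,\dots\}$, and write $\pi_k=\mathbb P(K=k)$. Conditionally on $K=k$, let $(s_1,\dots,s_k)\sim\operatorname{Dirichlet}(\alpha/k,\dots,\alpha/k)$, and conditionally on $K=k$ and $(s_1,\dots,s_k)$ let $y_1,y_2,\dots$ be i.i.d. with $\mathbb P(y_i=j)=s_j$ for $1\le j\le k$. Let $x^*$ be the outcome with label $1$ and $H_n(x^* )=\{y_1=\dots=y_n=x^*\}$. Assume $\pi_1>0$ and $\pi_2>0$. Then for all $n\ge 1$, $$\frac{\pi_2}{2}\left(\frac{\alpha/2}{n-1+\alpha/2}\right)^{\alpha/2}\le 1-\mathbb P(K=1\mid H_n(x^* ))\le \frac{1-\pi_1}{\pi_1}\cdot\frac12\left(\frac{1+\alpha}{n+\alpha}\right)^{\alpha/2}.$$ Consequently $1-\mathbb P(K=1\mid H_n(x^* ))=\Theta(n^{-\alpha/2})$ as $n\to\infty$; hence $\mathbb P(K=1\mid H_n(x^* ))\to1$ at rate $n^{-\alpha/2}$.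
   Context: For $k=1$ the Dirichlet distribution is the point mass at $s_1=1$. The likelihood of $H_n(x^* )$ given $K=k$ is $\mathbb P(H_n(x^* )\mid K=k)=\mathbb E[s_1^n\mid K=k]$, and $\mathbb P(K=1\mid H_n(x^* ))$ is the posterior given by Bayes' rule. *)

theory Defs
  imports "HOL-Probability.Probability" "HOL-Library.Landau_Symbols"
begin

text \<open>
  The Dirichlet distribution with parameters \<open>a 1, \<dots>, a k\<close> (\<open>k \<ge> 1\<close>), as a measure on the
  vectors indexed by \<open>{1..k}\<close>. The coordinates \<open>1, \<dots>, k - 1\<close> have the usual density on the open
  simplex with respect to Lebesgue measure, and the last coordinate is one minus their sum.
  For \<open>k = 1\<close> the Lebesgue measure is the unit mass on the empty vector, so the definition
  gives the point mass at \<open>s\<^sub>1 = 1\<close>; see \<open>dirichlet_1\<close>.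
\<close>

definition dirichlet_density :: "nat \<Rightarrow> (nat \<Rightarrow> real) \<Rightarrow> (nat \<Rightarrow> real) \<Rightarrow> real" where
  "dirichlet_density k a x =
     (if (\<forall>i\<in>{1..<k}. 0 < x i) \<and> (\<Sum>i\<in>{1..<k}. x i) < 1
      then Gamma (\<Sum>i\<in>{1..k}. a i) / (\<Prod>i\<in>{1..k}. Gamma (a i)) *
           (\<Prod>i\<in>{1..<k}. x i powr (a i - 1)) * (1 - (\<Sum>i\<in>{1..<k}. x i)) powr (a k - 1)
      else 0)"

definition dirichlet :: "nat \<Rightarrow> (nat \<Rightarrow> real) \<Rightarrow> (nat \<Rightarrow> real) measure" where
  "dirichlet k a =
     distr (density (PiM {1..<k} (\<lambda>_. lborel)) (\<lambda>x. ennreal (dirichlet_density k a x)))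
           (PiM {1..k} (\<lambda>_. borel))
           (\<lambda>x. x(k := 1 - (\<Sum>i\<in>{1..<k}. x i)))"

lemma dirichlet_density_measurable [measurable]:
  "dirichlet_density k a \<in> borel_measurable (PiM {1..<k} (\<lambda>_. lborel))"
  unfolding dirichlet_density_def by measurable

lemma dirichlet_last_measurable [measurable]:
  fixes k :: nat
  assumes "k \<ge> 1"
  shows "(\<lambda>x. x(k := 1 - (\<Sum>i\<in>{1..<k}. x i))) \<in> PiM {1..<k} (\<lambda>_. lborel) \<rightarrow>\<^sub>M PiM {1..k} (\<lambda>_. borel :: real measure)"
proof (rule measurable_PiM_single')
  fix i assume i: "i \<in> {1..k}"
  show "(\<lambda>x. (x(k := 1 - (\<Sum>i\<in>{1..<k}. x i))) i) \<in> borel_measurable (PiM {1..<k} (\<lambda>_. lborel :: real measure))"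
  proof (cases "i = k")
    case False
    then have "(\<lambda>x. x i) \<in> PiM {1..<k} (\<lambda>_. lborel) \<rightarrow>\<^sub>M (lborel :: real measure)"
      using i by (intro measurable_component_singleton) auto
    then show ?thesis
      using False by simp
  qed simp
next
  show "(\<lambda>x. x(k := 1 - (\<Sum>i\<in>{1..<k}. x i))) \<in> space (PiM {1..<k} (\<lambda>_. lborel :: real measure)) \<rightarrow> (\<Pi>\<^sub>E i\<in>{1..k}. space (borel :: real measure))"
    using assms by (auto simp: space_PiM PiE_def extensional_def)
qed

lemma dirichlet_1:
  assumes "a 1 > 0"
  shows "dirichlet 1 a = return (PiM {1..1} (\<lambda>_. borel)) (\<lambda>j\<in>{1..1}. 1)"
proof -
  have "Gamma (a 1) > 0"
    using assms by (rule Gamma_real_pos)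
  then have d: "dirichlet_density 1 a = (\<lambda>_. 1)"
    by (auto simp: dirichlet_density_def fun_eq_iff)
  have e: "PiM {1..<1::nat} (\<lambda>_. lborel :: real measure) = return (count_space {\<lambda>_. undefined}) (\<lambda>_. undefined)"
    by (rule measure_eqI) (auto simp: PiM_empty emeasure_count_space_finite subset_singleton_iff)
  have f: "(\<lambda>_. undefined)(1 := 1) = (\<lambda>j\<in>{1..1::nat}. 1 :: real)"
    by auto
  show ?thesis
    unfolding dirichlet_def d e
    by (subst ennreal_1, subst density_1, subst distr_return) (auto simp: f space_PiM f[simplified])
qed

text \<open>
  Given the sub-\<open>\<sigma>\<close>-algebra \<open>G\<close>, the labels \<open>y 1, y 2, \<dots>\<close> are independent and each \<open>y i\<close> takes
  the value \<open>j \<in> L\<close> with conditional probability \<open>p j\<close>.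
\<close>

definition cond_iid_labels ::
  "'a measure \<Rightarrow> 'a measure \<Rightarrow> nat set \<Rightarrow> (nat \<Rightarrow> 'a \<Rightarrow> real) \<Rightarrow> (nat \<Rightarrow> 'a \<Rightarrow> nat) \<Rightarrow> bool" where
  "cond_iid_labels N G L p y \<longleftrightarrow>
     (\<forall>i\<ge>1. \<forall>j\<in>L. AE \<omega> in N.
        real_cond_exp N G (indicator {\<omega>\<in>space N. y i \<omega> = j}) \<omega> = p j \<omega>) \<and>
     (\<forall>I B. finite I \<longrightarrow> I \<subseteq> {1..} \<longrightarrow> (AE \<omega> in N.
        real_cond_exp N G (indicator {\<omega>\<in>space N. \<forall>i\<in>I. y i \<omega> \<in> B i}) \<omega> =
        (\<Prod>i\<in>I. real_cond_exp N G (indicator {\<omega>\<in>space N. y i \<omega> \<in> B i}) \<omega>)))"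

text \<open>
  The hierarchical model. Conditioning on \<open>K = k\<close> is only meaningful when this event has positive
  probability. Only \<open>s 1, \<dots>, s k\<close> matter on the event \<open>K = k\<close>: the random vector \<open>S\<close> below
  discards the other \<open>s j\<close>, on which nothing is assumed except measurability.
\<close>

definition dirichlet_label_model ::
  "'a measure \<Rightarrow> real \<Rightarrow> ('a \<Rightarrow> nat) \<Rightarrow> (nat \<Rightarrow> 'a \<Rightarrow> real) \<Rightarrow> (nat \<Rightarrow> 'a \<Rightarrow> nat) \<Rightarrow> bool" where
  "dirichlet_label_model M \<alpha> K s y \<longleftrightarrow>
     prob_space M \<and>
     K \<in> M \<rightarrow>\<^sub>M count_space UNIV \<and> (\<forall>\<omega>\<in>space M. K \<omega> \<ge> 1) \<and>
     (\<forall>j. s j \<in> borel_measurable M) \<and>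
     (\<forall>i. y i \<in> M \<rightarrow>\<^sub>M count_space UNIV) \<and>
     (\<forall>k\<ge>1. \<P>(\<omega> in M. K \<omega> = k) > 0 \<longrightarrow>
        (let N = uniform_measure M {\<omega>\<in>space M. K \<omega> = k};
             S = (\<lambda>\<omega>. \<lambda>j\<in>{1..k}. s j \<omega>)
         in distr N (PiM {1..k} (\<lambda>_. borel)) S = dirichlet k (\<lambda>_. \<alpha> / real k) \<and>
            cond_iid_labels N (vimage_algebra (space N) S (PiM {1..k} (\<lambda>_. borel))) {1..k} s y))"

end

theory Submission
  imports Defs "HOL-Real_Asymp.Real_Asymp"
begin

text \<open>
  Under the Dirichlet distribution the first coordinate has \<open>n\<close>-th moment
  \<open>(\<alpha>/k)\<^sub>n / (\<alpha>)\<^sub>n\<close> (rising factorials), and by conditional independence this is the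
  likelihood of the run given \<open>K = k\<close>. It equals \<open>1\<close> for \<open>k = 1\<close> and decreases in \<open>k\<close>, so
  Bayes' rule traps the posterior mass of \<open>K \<noteq> 1\<close> between multiples of the likelihood for
  \<open>k = 2\<close>. The latter is a product of factors \<open>(\<alpha>/2 + m) / (\<alpha> + m)\<close>, each compared with
  the increment of a power by means of \<open>1 + t \<le> exp t\<close>.
\<close>

section \<open>Beta and Dirichlet integrals, and the moments of the first coordinate\<close>

lemma Beta_real_pos: "a > 0 \<Longrightarrow> b > 0 \<Longrightarrow> Beta a b > (0 :: real)"
  by (simp add: Beta_def)

text \<open>The substitution of \<open>u * x\<close> for \<open>x\<close> reduces this to Euler's
  integral on the unit interval. The Jacobian contributes \<open>u\<close> and the two powers
  contribute \<open>u powr (a + b - 2)\<close>.\<close>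

lemma nn_integral_Beta:
  fixes a b u :: real
  assumes "a > 0" "b > 0" "u > 0"
  shows "(\<integral>\<^sup>+x. ennreal (if 0 < x \<and> x < u then x powr (a - 1) * (u - x) powr (b - 1) else 0) \<partial>lborel) =
         ennreal (u powr (a + b - 1) * Beta a b)"
proof -
  have unit: "(\<integral>\<^sup>+x. ennreal (if 0 < x \<and> x < 1 then x powr (a - 1) * (1 - x) powr (b - 1) else 0) \<partial>lborel) =
      ennreal (Beta a b)"
  proof (rule nn_integral_has_integral_lborel)
    \<comment> \<open>The known Beta integral is over the closed interval; the endpoints form a null
      set.\<close>
    show "((\<lambda>x. if 0 < x \<and> x < 1 then x powr (a - 1) * (1 - x) powr (b - 1) else 0) has_integral Beta a b) UNIV"
      using has_integral_Beta_real[OF assms(1,2)]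
      by (subst (asm) has_integral_restrict_UNIV[symmetric])
        (auto elim!: has_integral_spike[of "{0,1}", rotated 2] split: if_splits)
  qed auto
  have "(\<integral>\<^sup>+x. ennreal (if 0 < x \<and> x < u then x powr (a - 1) * (u - x) powr (b - 1) else 0) \<partial>lborel) =
      ennreal u * (\<integral>\<^sup>+x. ennreal (if 0 < u * x \<and> u * x < u then (u * x) powr (a - 1) * (u - u * x) powr (b - 1) else 0) \<partial>lborel)"
    using assms by (subst nn_integral_real_affine[where c = u and t = 0]) (auto cong: if_cong)
  also have "\<dots> = ennreal u * (\<integral>\<^sup>+x. ennreal (u powr (a + b - 2)) *
      ennreal (if 0 < x \<and> x < 1 then x powr (a - 1) * (1 - x) powr (b - 1) else 0) \<partial>lborel)"
  proof -
    have "(u * x) powr (a - 1) * (u - u * x) powr (b - 1) =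
        u powr (a + b - 2) * (x powr (a - 1) * (1 - x) powr (b - 1))" if "0 < x" "x < 1" for x
    proof -
      have "u - u * x = u * (1 - x)" by (simp add: algebra_simps)
      moreover have "u powr (a + b - 2) = u powr (a - 1) * u powr (b - 1)"
        by (simp flip: powr_add)
      ultimately show ?thesis
        using assms that by (simp add: powr_mult)
    qed
    then show ?thesis
      using assms by (auto simp: zero_less_mult_iff simp flip: ennreal_mult' intro!: nn_integral_cong arg_cong2[where f = "(*)"])
  qed
  also have "\<dots> = ennreal (u * (u powr (a + b - 2) * Beta a b))"
    using assms Beta_real_pos[of a b] by (simp add: nn_integral_cmult unit ennreal_mult')
  also have "u * (u powr (a + b - 2) * Beta a b) = u powr (a + b - 1) * Beta a b"
  proof -
    have "u powr (a + b - 1) = u powr 1 * u powr (a + b - 2)"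
      unfolding powr_add[symmetric] by (simp add: algebra_simps)
    then show ?thesis using assms by simp
  qed
  finally show ?thesis .
qed

text \<open>Integrating out one coordinate \<open>j\<close> leaves the kernel for \<open>J\<close> with \<open>b\<close> replaced by \<open>a j + b\<close>.\<close>

lemma nn_integral_dirichlet_kernel:
  fixes a :: "'i \<Rightarrow> real"
  assumes "finite J" "\<And>i. i \<in> J \<Longrightarrow> a i > 0" "b > 0"
  shows "(\<integral>\<^sup>+x. ennreal (if (\<forall>i\<in>J. 0 < x i) \<and> (\<Sum>i\<in>J. x i) < 1
             then (\<Prod>i\<in>J. x i powr (a i - 1)) * (1 - (\<Sum>i\<in>J. x i)) powr (b - 1) else 0) \<partial>PiM J (\<lambda>_. lborel)) =
         ennreal ((\<Prod>i\<in>J. Gamma (a i)) * Gamma b / Gamma (sum a J + b))"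
  using assms
proof (induction J arbitrary: b)
  case empty
  \<comment> \<open>With no coordinates the measure is the unit mass on one point and the claim is
    \<open>1 = Gamma b / Gamma b\<close>, where positivity permits the cancellation.\<close>
  then have "Gamma b > 0" by (intro Gamma_real_pos)
  then show ?case
    by (simp add: PiM_empty nn_integral_count_space_finite)
next
  case (insert j J)
  interpret product_sigma_finite "\<lambda>_::'i. lborel :: real measure" ..
  let ?f = "\<lambda>x. ennreal (if (\<forall>i\<in>insert j J. 0 < x i) \<and> (\<Sum>i\<in>insert j J. x i) < 1
             then (\<Prod>i\<in>insert j J. x i powr (a i - 1)) * (1 - (\<Sum>i\<in>insert j J. x i)) powr (b - 1) else 0)"
  have aj: "a j > 0" using insert.prems by simp
  have Beta_nonneg: "Beta (a j) b \<ge> 0"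
    using aj insert.prems by (intro less_imp_le Beta_real_pos) auto
  have [measurable]: "finite (insert j J)" "countable (insert j J)" using insert.hyps by (auto intro: countable_finite)
  have "?f \<in> borel_measurable (PiM (insert j J) (\<lambda>_. lborel))"
    using measurable_component_singleton[of _ "insert j J" "\<lambda>_. lborel :: real measure"]
    by measurable
  then have "integral\<^sup>N (PiM (insert j J) (\<lambda>_. lborel)) ?f =
      (\<integral>\<^sup>+x. \<integral>\<^sup>+y. ?f (x(j := y)) \<partial>lborel \<partial>PiM J (\<lambda>_. lborel))"
    using insert.hyps by (intro product_nn_integral_insert) auto
  also have "\<dots> = (\<integral>\<^sup>+x. ennreal (Beta (a j) b) * ennreal (if (\<forall>i\<in>J. 0 < x i) \<and> (\<Sum>i\<in>J. x i) < 1
             then (\<Prod>i\<in>J. x i powr (a i - 1)) * (1 - (\<Sum>i\<in>J. x i)) powr (a j + b - 1) else 0) \<partial>PiM J (\<lambda>_. lborel))"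
  proof (rule nn_integral_cong)
    fix x :: "'i \<Rightarrow> real"
    have upd: "sum (x(j := y)) (insert j J) = y + (\<Sum>i\<in>J. x i)"
      "(\<forall>i\<in>insert j J. 0 < (x(j := y)) i) \<longleftrightarrow> 0 < y \<and> (\<forall>i\<in>J. 0 < x i)"
      "(\<Prod>i\<in>insert j J. (x(j := y)) i powr (a i - 1)) = y powr (a j - 1) * (\<Prod>i\<in>J. x i powr (a i - 1))" for y
      using insert.hyps by (auto intro!: sum.cong prod.cong)
    show "(\<integral>\<^sup>+y. ?f (x(j := y)) \<partial>lborel) = ennreal (Beta (a j) b) * ennreal (if (\<forall>i\<in>J. 0 < x i) \<and> (\<Sum>i\<in>J. x i) < 1
             then (\<Prod>i\<in>J. x i powr (a i - 1)) * (1 - (\<Sum>i\<in>J. x i)) powr (a j + b - 1) else 0)"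
    proof (cases "(\<forall>i\<in>J. 0 < x i) \<and> (\<Sum>i\<in>J. x i) < 1")
      case True
      have p: "(\<Prod>i\<in>J. x i powr (a i - 1)) \<ge> 0" by (intro prod_nonneg) auto
      \<comment> \<open>With the other coordinates fixed, \<open>y\<close> ranges over the open
        interval from 0 to \<open>1 - (\<Sum>i\<in>J. x i)\<close>, so the inner integral is a Beta
        integral whose \<open>u\<close> is the remaining mass.\<close>
      have "(\<integral>\<^sup>+y. ?f (x(j := y)) \<partial>lborel) = (\<integral>\<^sup>+y. ennreal (\<Prod>i\<in>J. x i powr (a i - 1)) *
          ennreal (if 0 < y \<and> y < 1 - (\<Sum>i\<in>J. x i) then y powr (a j - 1) * ((1 - (\<Sum>i\<in>J. x i)) - y) powr (b - 1) else 0) \<partial>lborel)"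
        unfolding upd using True p
        by (intro nn_integral_cong) (auto simp: algebra_simps simp flip: ennreal_mult')
      also have "\<dots> = ennreal (\<Prod>i\<in>J. x i powr (a i - 1)) * ennreal ((1 - (\<Sum>i\<in>J. x i)) powr (a j + b - 1) * Beta (a j) b)"
        using True aj insert.prems by (subst nn_integral_cmult) (auto simp: nn_integral_Beta)
      finally show ?thesis
        using True p Beta_nonneg by (simp add: mult_ac flip: ennreal_mult')
    next
      case False
      \<comment> \<open>A point already outside the simplex stays outside: a positive
        \<open>y\<close> only increases the sum.\<close>
      then have "?f (x(j := y)) = 0" for y
        unfolding upd by auto
      with False show ?thesis by auto
    qed
  qed
  also have "\<dots> = ennreal (Beta (a j) b) * ennreal ((\<Prod>i\<in>J. Gamma (a i)) * Gamma (a j + b) / Gamma (sum a J + (a j + b)))"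
  proof -
    have [measurable]: "finite J" "countable J" using insert.hyps by (auto intro: countable_finite)
    have "(\<lambda>x. ennreal (if (\<forall>i\<in>J. 0 < x i) \<and> (\<Sum>i\<in>J. x i) < 1
        then (\<Prod>i\<in>J. x i powr (a i - 1)) * (1 - (\<Sum>i\<in>J. x i)) powr (a j + b - 1) else 0))
        \<in> borel_measurable (PiM J (\<lambda>_. lborel))"
      using measurable_component_singleton[of _ J "\<lambda>_. lborel :: real measure"] by measurable
    moreover have "\<And>i. i \<in> J \<Longrightarrow> a i > 0" using insert.prems by simp
    ultimately show ?thesis
      using insert.IH[OF _ add_pos_pos[OF aj insert.prems(2)]] by (simp only: nn_integral_cmult)
  qed
  also have "\<dots> = ennreal ((\<Prod>i\<in>insert j J. Gamma (a i)) * Gamma b / Gamma (sum a (insert j J) + b))"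
  proof -
    \<comment> \<open>The induction hypothesis was taken at \<open>a j + b\<close>; its factor
      \<open>Gamma (a j + b)\<close> now cancels the denominator of \<open>Beta (a j) b\<close> and
      leaves \<open>Gamma (a j) * Gamma b\<close>.\<close>
    have "Gamma (a j + b) > 0"
      using add_pos_pos[OF aj insert.prems(2)] by (rule Gamma_real_pos)
    with Beta_nonneg show ?thesis
      using insert.hyps by (simp add: Beta_def add_ac mult_ac flip: ennreal_mult')
  qed
  finally show ?case .
qed


text \<open>Weighting the density by \<open>x 1 ^ n\<close> only shifts the parameter \<open>a 1\<close> to \<open>a 1 + n\<close>.\<close>

lemma nn_integral_dirichlet_power:
  assumes "k \<ge> 1" "\<And>i. i \<in> {1..k} \<Longrightarrow> a i > 0"
  shows "(\<integral>\<^sup>+x. ennreal (x 1 ^ n) \<partial>dirichlet k a) =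
         ennreal (pochhammer (a 1) n / pochhammer (\<Sum>i\<in>{1..k}. a i) n)"
proof (cases "k = 1")
  \<comment> \<open>For \<open>k = 1\<close> coordinate 1 is the dependent last one and does not
    occur in the density, so the point mass is used instead; both sides are 1.\<close>
  case True
  have "pochhammer (a 1) n > 0"
    using assms True by (intro pochhammer_pos) auto
  moreover have "(\<lambda>x. ennreal (x 1 ^ n)) \<in> borel_measurable (PiM {1..1::nat} (\<lambda>_. borel))"
  proof -
    have [measurable]: "(\<lambda>x. x 1) \<in> borel_measurable (PiM {1..1::nat} (\<lambda>_. borel :: real measure))"
      by (intro measurable_component_singleton) auto
    show ?thesis by measurable
  qed
  moreover have "dirichlet 1 a = return (PiM {1..1} (\<lambda>_. borel)) (\<lambda>j\<in>{1..1}. 1)"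
    using assms True by (intro dirichlet_1) auto
  ultimately show ?thesis
    using True by (simp add: nn_integral_return space_PiM)
next
  case False
  then have k: "k \<ge> 2" using assms by simp
  define A where "A = (\<Sum>i\<in>{1..k}. a i)"
  define C where "C = Gamma A / (\<Prod>i\<in>{1..k}. Gamma (a i))"
  define a' where "a' = a(1 := a 1 + real n)"
  define ker where "ker x = (if (\<forall>i\<in>{1..<k}. 0 < x i) \<and> (\<Sum>i\<in>{1..<k}. x i) < 1
      then (\<Prod>i\<in>{1..<k}. x i powr (a' i - 1)) * (1 - (\<Sum>i\<in>{1..<k}. x i)) powr (a k - 1) else 0)"
    for x :: "nat \<Rightarrow> real"
  have split_last: "{1..k} = insert k {1..<k}" and split_first: "{1..<k} = insert 1 {2..<k}"
    using k by auto
  have pos: "a 1 > 0" "A > 0" and prod_pos: "(\<Prod>i\<in>{2..<k}. Gamma (a i)) > 0" "Gamma (a k) > 0"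
    using assms k unfolding A_def by (auto intro!: sum_pos prod_pos)
  have C: "C \<ge> 0"
    unfolding C_def using assms pos by (intro divide_nonneg_nonneg prod_nonneg) (auto intro: less_imp_le)
  have [measurable]: "(\<lambda>x. ennreal (x 1 ^ n)) \<in> borel_measurable (PiM {1..k} (\<lambda>_. borel))"
  proof -
    have [measurable]: "(\<lambda>x. x 1) \<in> borel_measurable (PiM {1..k} (\<lambda>_. borel :: real measure))"
      using k by (intro measurable_component_singleton) auto
    show ?thesis by measurable
  qed
  have [measurable]: "ker \<in> borel_measurable (PiM {1..<k} (\<lambda>_. lborel))"
    unfolding ker_def by measurable
  note [measurable] = dirichlet_last_measurable[OF assms(1)]
  have "(\<integral>\<^sup>+x. ennreal (x 1 ^ n) \<partial>dirichlet k a) =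
      (\<integral>\<^sup>+x. ennreal (dirichlet_density k a x) * ennreal (x 1 ^ n) \<partial>PiM {1..<k} (\<lambda>_. lborel))"
  proof -
    have "(\<integral>\<^sup>+x. ennreal (x 1 ^ n) \<partial>dirichlet k a) =
        (\<integral>\<^sup>+x. ennreal ((x(k := 1 - (\<Sum>i\<in>{1..<k}. x i))) 1 ^ n)
          \<partial>density (PiM {1..<k} (\<lambda>_. lborel)) (\<lambda>x. ennreal (dirichlet_density k a x)))"
      unfolding dirichlet_def by (rule nn_integral_distr) measurable
    also have "\<dots> = (\<integral>\<^sup>+x. ennreal (dirichlet_density k a x) *
        ennreal ((x(k := 1 - (\<Sum>i\<in>{1..<k}. x i))) 1 ^ n) \<partial>PiM {1..<k} (\<lambda>_. lborel))"
    proof (rule nn_integral_density)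
      show "(\<lambda>x. ennreal ((x(k := 1 - (\<Sum>i\<in>{1..<k}. x i))) 1 ^ n)) \<in> borel_measurable (PiM {1..<k} (\<lambda>_. lborel))"
        by (rule measurable_compose[OF dirichlet_last_measurable[OF assms(1)]]) measurable
    qed measurable
    \<comment> \<open>Since \<open>k\<close> is at least 2, the update at \<open>k\<close> leaves
      coordinate 1 unchanged.\<close>
    finally show ?thesis using k by simp
  qed
  also have "\<dots> = (\<integral>\<^sup>+x. ennreal C * ennreal (ker x) \<partial>PiM {1..<k} (\<lambda>_. lborel))"
  proof (rule nn_integral_cong)
    fix x :: "nat \<Rightarrow> real"
    have "x 1 powr (a 1 + real n - 1) = x 1 powr (a 1 - 1) * x 1 ^ n" if "x 1 > 0"
    proof -
      have "x 1 powr (a 1 + real n - 1) = x 1 powr (a 1 - 1) * x 1 powr real n"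
        by (simp add: algebra_simps flip: powr_add)
      then show ?thesis using that by (simp add: powr_realpow)
    qed
    then have "dirichlet_density k a x * x 1 ^ n = C * ker x"
      unfolding dirichlet_density_def ker_def C_def A_def a'_def split_first by auto
    \<comment> \<open>\<open>ennreal\<close> sends negative numbers to 0, so it commutes with the
      product only if a factor is nonnegative. Off the simplex \<open>x 1 ^ n\<close> can be
      negative, but there the density vanishes.\<close>
    moreover have "x 1 ^ n \<ge> 0 \<or> dirichlet_density k a x = 0"
      unfolding dirichlet_density_def split_first by (auto intro: less_imp_le)
    ultimately show "ennreal (dirichlet_density k a x) * ennreal (x 1 ^ n) = ennreal C * ennreal (ker x)"
      using C by (auto simp flip: ennreal_mult' ennreal_mult'')
  qed
  also have "\<dots> = ennreal C * ennreal ((\<Prod>i\<in>{1..<k}. Gamma (a' i)) * Gamma (a k) / Gamma (sum a' {1..<k} + a k))"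
  proof -
    have a': "a' i > 0" if "i \<in> {1..<k}" for i
      using assms(2)[of i] that unfolding a'_def by auto
    have "(\<integral>\<^sup>+x. ennreal (ker x) \<partial>PiM {1..<k} (\<lambda>_. lborel)) =
        ennreal ((\<Prod>i\<in>{1..<k}. Gamma (a' i)) * Gamma (a k) / Gamma (sum a' {1..<k} + a k))"
      unfolding ker_def by (rule nn_integral_dirichlet_kernel) (use a' assms in auto)
    moreover have "(\<lambda>x. ennreal (ker x)) \<in> borel_measurable (PiM {1..<k} (\<lambda>_. lborel))"
      by measurable
    ultimately show ?thesis
      by (simp only: nn_integral_cmult)
  qed
  also have "\<dots> = ennreal (C * ((\<Prod>i\<in>{1..<k}. Gamma (a' i)) * Gamma (a k) / Gamma (sum a' {1..<k} + a k)))"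
    using C by (rule ennreal_mult'[symmetric])
  also have "C * ((\<Prod>i\<in>{1..<k}. Gamma (a' i)) * Gamma (a k) / Gamma (sum a' {1..<k} + a k)) =
      pochhammer (a 1) n / pochhammer A n"
  proof -
    \<comment> \<open>The Gamma factors of all coordinates other than 1 cancel. What remains are the
      Gamma quotients at \<open>a 1\<close> and at the total \<open>A\<close>, each of which is a
      rising factorial.\<close>
    have "sum a' {1..<k} + a k = A + real n"
      unfolding A_def a'_def split_last split_first using k by simp
    moreover have "(\<Prod>i\<in>{1..<k}. Gamma (a' i)) = Gamma (a 1 + real n) * (\<Prod>i\<in>{2..<k}. Gamma (a i))"
      unfolding a'_def split_first by simp
    moreover have "(\<Prod>i\<in>{1..k}. Gamma (a i)) = Gamma (a 1) * (\<Prod>i\<in>{2..<k}. Gamma (a i)) * Gamma (a k)"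
      unfolding split_last split_first using k by simp
    moreover have "pochhammer (a 1) n = Gamma (a 1 + real n) / Gamma (a 1)" "pochhammer A n = Gamma (A + real n) / Gamma A"
      using pos by (auto intro!: pochhammer_Gamma elim!: nonpos_Ints_cases)
    ultimately show ?thesis
      using prod_pos pos[THEN Gamma_real_pos] unfolding C_def
      by (simp del: prod_zero_iff)
  qed
  finally show ?thesis unfolding A_def .
qed

section \<open>Probability of a constant run under conditionally i.i.d. labels\<close>

text \<open>Conditional independence turns the conditional probability of the run into a product of
  \<open>n\<close> factors, each almost surely \<open>p j\<close>. Integrating a conditional
  expectation recovers the unconditional probability.\<close>

lemma emeasure_constant_labels:
  assumes "prob_space N" "subalgebra N G" "cond_iid_labels N G L p y" "j \<in> L"
    and y [measurable]: "\<And>i. y i \<in> N \<rightarrow>\<^sub>M count_space UNIV"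
  shows "emeasure N {\<omega>\<in>space N. \<forall>i\<in>{1..n}. y i \<omega> = j} = (\<integral>\<^sup>+\<omega>. ennreal (p j \<omega> ^ n) \<partial>N)"
proof -
  interpret prob_space N by fact
  interpret finite_measure_subalgebra N G by standard fact
  let ?H = "{\<omega>\<in>space N. \<forall>i\<in>{1..n}. y i \<omega> = j}"
  let ?c = "real_cond_exp N G (indicator ?H)"
  have single: "AE \<omega> in N. real_cond_exp N G (indicator {\<omega>\<in>space N. y i \<omega> = j}) \<omega> = p j \<omega>" if "i \<ge> 1" for i
    using assms(3,4) that unfolding cond_iid_labels_def by blast
  have "AE \<omega> in N. \<forall>i\<in>{1..n}. real_cond_exp N G (indicator {\<omega>\<in>space N. y i \<omega> = j}) \<omega> = p j \<omega>"
    using single by (intro AE_finite_allI) auto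
  moreover have "AE \<omega> in N. real_cond_exp N G (indicator {\<omega>\<in>space N. \<forall>i\<in>{1..n}. y i \<omega> \<in> {j}}) \<omega> =
        (\<Prod>i\<in>{1..n}. real_cond_exp N G (indicator {\<omega>\<in>space N. y i \<omega> \<in> {j}}) \<omega>)"
    using assms(3) unfolding cond_iid_labels_def by (elim conjE allE[of _ "{1..n}"] allE[of _ "\<lambda>_. {j}"]) auto
  ultimately have eq: "AE \<omega> in N. p j \<omega> ^ n = ?c \<omega>"
    by eventually_elim simp
  have H: "?H \<in> sets N" by measurable
  then have int: "integrable N (indicator ?H :: _ \<Rightarrow> real)"
    by (intro integrable_real_indicator) (auto simp: emeasure_eq_measure)
  have "(\<integral>\<^sup>+\<omega>. ennreal (p j \<omega> ^ n) \<partial>N) = (\<integral>\<^sup>+\<omega>. ennreal (?c \<omega>) \<partial>N)"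
    using eq by (intro nn_integral_cong_AE) auto
  also have "\<dots> = ennreal (\<integral>\<omega>. ?c \<omega> \<partial>N)"
    using H by (intro nn_integral_eq_integral real_cond_exp_int int real_cond_exp_pos) auto
  also have "\<dots> = emeasure N ?H"
    using H int by (simp add: real_cond_exp_int emeasure_eq_measure)
  finally show ?thesis by simp
qed

section \<open>Power bounds for ratios of rising factorials\<close>

lemma pochhammer_mono:
  fixes a b :: real
  assumes "0 < a" "a \<le> b"
  shows "pochhammer a n \<le> pochhammer b n"
  using assms by (induction n) (auto simp: pochhammer_Suc intro!: mult_mono pochhammer_nonneg)

text \<open>This is \<open>ln (1 + t) \<le> t\<close> multiplied by \<open>a\<close> and
  exponentiated. Both signs of \<open>t\<close> occur below: \<open>1 / c\<close> for the upper
  bound and \<open>- 1 / c\<close> for the lower one.\<close>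

lemma one_plus_powr_le_exp:
  fixes a t :: real
  assumes "a \<ge> 0" "t > -1"
  shows "(1 + t) powr a \<le> exp (a * t)"
proof -
  have "a * ln (1 + t) \<le> a * t"
    using assms ln_le_minus_one[of "1 + t"] by (intro mult_left_mono) auto
  then show ?thesis using assms by (simp add: powr_def)
qed

text \<open>Equality holds at \<open>n = 1\<close>. Passing from \<open>n\<close> to
  \<open>Suc n\<close> multiplies the left side by \<open>(a + n) / (2 * a + n)\<close> and the
  right side by \<open>((2 * a + n) / (2 * a + n + 1)) powr a\<close>, so it suffices to compare
  these factors.\<close>

lemma pochhammer_half_ratio_le:
  fixes a :: real
  assumes "a > 0" "n \<ge> 1"
  shows "pochhammer a n / pochhammer (2 * a) n \<le> 1 / 2 * ((1 + 2 * a) / (real n + 2 * a)) powr a"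
  using assms(2)
proof (induction n rule: nat_induct_at_least)
  case base
  then show ?case using assms by simp
next
  case (Suc n)
  define c where "c = real n + 2 * a"
  have c: "c > 0" using assms Suc.hyps by (simp add: c_def)
  \<comment> \<open>The two factors are separated by \<open>exp (- (a / c))\<close>: the first is
    \<open>1 - a / c\<close>, the second the inverse of \<open>(1 + 1 / c) powr a\<close>.\<close>
  have "(a + real n) / c = 1 - a * (1 / c)"
    using c by (simp add: c_def field_simps)
  also have "\<dots> \<le> exp (- (a * (1 / c)))"
    using exp_ge_add_one_self[of "- (a * (1 / c))"] by simp
  also have "\<dots> \<le> inverse ((1 + 1 / c) powr a)"
  proof -
    have t: "1 / c > 0" using c by simp
    then have "1 + 1 / c > 0" by linarith
    moreover have "(1 + 1 / c) powr a \<le> exp (a * (1 / c))"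
      by (rule one_plus_powr_le_exp) (use t assms(1) in linarith)+
    ultimately show ?thesis
      unfolding exp_minus by (intro le_imp_inverse_le) auto
  qed
  also have "\<dots> = (inverse (1 + 1 / c)) powr a"
    by (rule inverse_powr[symmetric])
  also have "inverse (1 + 1 / c) = c / (c + 1)"
    using c by (simp add: field_simps)
  finally have step: "(a + real n) / c \<le> (c / (c + 1)) powr a" .
  have "pochhammer a (Suc n) / pochhammer (2 * a) (Suc n) =
      pochhammer a n / pochhammer (2 * a) n * ((a + real n) / c)"
    by (simp add: pochhammer_Suc c_def add_ac)
  also have "\<dots> \<le> 1 / 2 * ((1 + 2 * a) / c) powr a * (c / (c + 1)) powr a"
    using Suc.IH step assms(1) c unfolding c_def
    by (intro mult_mono) (auto intro!: divide_nonneg_nonneg)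
  also have "\<dots> = 1 / 2 * ((1 + 2 * a) / c * (c / (c + 1))) powr a"
    using c assms(1) by (subst powr_mult) auto
  also have "(1 + 2 * a) / c * (c / (c + 1)) = (1 + 2 * a) / (real (Suc n) + 2 * a)"
    using c by (simp add: c_def add_ac)
  finally show ?case .
qed

text \<open>Again equality holds at \<open>n = 1\<close>, and the factors are compared: the
  right-hand power changes by \<open>((n - 1 + a) / (n + a)) powr a\<close>, which is at most
  \<open>(a + n) / (2 * a + n)\<close>.\<close>

lemma pochhammer_half_ratio_ge:
  fixes a :: real
  assumes "a > 0" "n \<ge> 1"
  shows "pochhammer a n / pochhammer (2 * a) n \<ge> 1 / 2 * (a / (real n - 1 + a)) powr a"
  using assms(2)
proof (induction n rule: nat_induct_at_least)
  case base
  then show ?case using assms by simp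
next
  case (Suc n)
  define c where "c = real n + a"
  have c: "c > 0" "c - 1 > 0" using assms Suc.hyps by (auto simp: c_def)
  \<comment> \<open>With \<open>c\<close> now equal to \<open>n + a\<close>, the new factor of the
    ratio is the inverse of \<open>1 + a / c\<close>, and \<open>exp (- (a / c))\<close> separates
    it from the power.\<close>
  have "((c - 1) / c) powr a = (1 + (- 1 / c)) powr a"
    using c by (simp add: field_simps)
  also have "\<dots> \<le> exp (- (a / c))"
    using one_plus_powr_le_exp[of a "- 1 / c"] assms(1) c by (simp add: field_simps)
  also have "\<dots> \<le> inverse (1 + a / c)"
    using exp_ge_add_one_self[of "a / c"] assms(1) c unfolding exp_minus
    by (intro le_imp_inverse_le) (auto intro: add_pos_pos)
  also have "\<dots> = (a + real n) / (2 * a + real n)"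
    using c assms(1) by (simp add: c_def field_simps)
  finally have step: "((c - 1) / c) powr a \<le> (a + real n) / (2 * a + real n)" .
  have "1 / 2 * (a / (real (Suc n) - 1 + a)) powr a = 1 / 2 * (a / (c - 1) * ((c - 1) / c)) powr a"
    using c by (simp add: c_def)
  also have "\<dots> = 1 / 2 * (a / (c - 1)) powr a * ((c - 1) / c) powr a"
    using c assms(1) by (subst powr_mult) auto
  also have "\<dots> \<le> pochhammer a n / pochhammer (2 * a) n * ((a + real n) / (2 * a + real n))"
    using Suc.IH step assms(1) c unfolding c_def
    by (intro mult_mono) (auto intro!: divide_nonneg_nonneg pochhammer_nonneg simp: algebra_simps)
  also have "\<dots> = pochhammer a (Suc n) / pochhammer (2 * a) (Suc n)"
    by (simp add: pochhammer_Suc)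
  finally show ?case .
qed

section \<open>Likelihoods and Bayes' rule\<close>

text \<open>The likelihood is the \<open>n\<close>-th Dirichlet moment of \<open>s 1\<close>.
  Stating it as a joint probability also covers values \<open>k\<close> of probability 0, where both
  sides vanish and the model prescribes no conditional law.\<close>

lemma prob_constant_labels:
  fixes M :: "'a measure"
  assumes "\<alpha> > 0" "dirichlet_label_model M \<alpha> K s y" "k \<ge> 1"
  shows "\<P>(\<omega> in M. K \<omega> = k \<and> (\<forall>i\<in>{1..n}. y i \<omega> = 1)) =
         \<P>(\<omega> in M. K \<omega> = k) * (pochhammer (\<alpha> / real k) n / pochhammer \<alpha> n)"
proof -
  note model = assms(2)[unfolded dirichlet_label_model_def]
  interpret prob_space M using model by blast
  have [measurable]: "K \<in> M \<rightarrow>\<^sub>M count_space UNIV" "\<And>j. s j \<in> borel_measurable M"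
      "\<And>i. y i \<in> M \<rightarrow>\<^sub>M count_space UNIV"
    using model by auto
  let ?E = "{\<omega>\<in>space M. K \<omega> = k}" and ?H = "{\<omega>\<in>space M. \<forall>i\<in>{1..n}. y i \<omega> = 1}"
  have inter: "?E \<inter> ?H = {\<omega>\<in>space M. K \<omega> = k \<and> (\<forall>i\<in>{1..n}. y i \<omega> = 1)}" by auto
  have sets: "?E \<in> sets M" "?H \<in> sets M" by measurable
  show ?thesis
  proof (cases "prob ?E = 0")
    case True
    have "prob (?E \<inter> ?H) \<le> prob ?E" using sets by (intro finite_measure_mono) auto
    with True show ?thesis unfolding inter[symmetric] by (simp add: measure_le_0_iff)
  next
    case False
    define N where "N = uniform_measure M ?E"
    define S where "S = (\<lambda>\<omega>. \<lambda>j\<in>{1..k}. s j \<omega>)"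
    define G where "G = vimage_algebra (space N) S (PiM {1..k} (\<lambda>_. borel :: real measure))"
    have "prob ?E > 0" using False by (simp add: zero_less_measure_iff)
    then have dist: "distr N (PiM {1..k} (\<lambda>_. borel)) S = dirichlet k (\<lambda>_. \<alpha> / real k)"
      and iid: "cond_iid_labels N G {1..k} s y"
      using model assms(3) unfolding N_def S_def G_def Let_def by blast+
    have E: "emeasure M ?E \<noteq> 0" "emeasure M ?E \<noteq> \<infinity>"
      using False by (auto simp: emeasure_eq_measure)
    have [measurable_cong]: "sets N = sets M" and space_N: "space N = space M"
      by (simp_all add: N_def)
    have N: "prob_space N" unfolding N_def by (rule prob_space_uniform_measure[OF E])
    have S: "S \<in> N \<rightarrow>\<^sub>M PiM {1..k} (\<lambda>_. borel)"
      unfolding S_def by measurable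
    have G: "subalgebra N G"
      unfolding subalgebra_def G_def using S measurable_space[OF S]
      by (subst sets_vimage_algebra2) (auto intro: measurable_sets)
    have meas: "(\<lambda>x. ennreal (x 1 ^ n)) \<in> borel_measurable (PiM {1..k} (\<lambda>_. borel :: real measure))"
    proof -
      have [measurable]: "(\<lambda>x. x 1) \<in> borel_measurable (PiM {1..k} (\<lambda>_. borel :: real measure))"
        using assms(3) by (intro measurable_component_singleton) auto
      show ?thesis by measurable
    qed
    have "emeasure N ?H = (\<integral>\<^sup>+\<omega>. ennreal (s 1 \<omega> ^ n) \<partial>N)"
      using emeasure_constant_labels[OF N G iid, of 1 n] assms(3) by (simp add: space_N)
    \<comment> \<open>Change of variables along \<open>S\<close>, which keeps coordinate 1 because
      \<open>k \<ge> 1\<close>.\<close>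
    also have "\<dots> = (\<integral>\<^sup>+x. ennreal (x 1 ^ n) \<partial>dirichlet k (\<lambda>_. \<alpha> / real k))"
      unfolding dist[symmetric] using assms(3) meas
      by (subst nn_integral_distr[OF S]) (simp_all add: S_def)
    also have "\<dots> = ennreal (pochhammer (\<alpha> / real k) n / pochhammer \<alpha> n)"
      using assms(1,3) by (subst nn_integral_dirichlet_power) auto
    finally have "measure N ?H = pochhammer (\<alpha> / real k) n / pochhammer \<alpha> n"
      using pochhammer_pos[of "\<alpha> / real k" n] pochhammer_pos[of \<alpha> n] assms(1,3) by (simp add: measure_def)
    moreover have "measure N ?H = prob (?E \<inter> ?H) / prob ?E"
      unfolding N_def by (rule measure_uniform_measure[OF E sets(2)])
    ultimately show ?thesis
      using False unfolding inter[symmetric] by (simp add: field_simps)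
  qed
qed

text \<open>By Bayes' rule \<open>1 - post n\<close> is the mass of the run outside
  \<open>K = 1\<close>, divided by the total mass of the run. The numerator sums prior times
  likelihood over \<open>k \<ge> 2\<close>: its term at \<open>k = 2\<close> bounds it below, and
  likelihoods decreasing in \<open>k\<close> bound it above. The denominator lies between the prior
  mass of \<open>K = 1\<close> and 1.\<close>

lemma posterior_complement_bounds:
  fixes M :: "'a measure"
  assumes \<alpha>: "\<alpha> > 0" and model: "dirichlet_label_model M \<alpha> K s y"
    and pos: "\<P>(\<omega> in M. K \<omega> = 1) > 0"
  defines "L \<equiv> \<lambda>n. pochhammer (\<alpha> / 2) n / pochhammer \<alpha> n"
  defines "post \<equiv> \<lambda>n. \<P>(\<omega> in M. K \<omega> = 1 \<bar> \<forall>i\<in>{1..n}. y i \<omega> = 1)"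
  shows "\<P>(\<omega> in M. K \<omega> = 2) * L n \<le> 1 - post n"
    and "1 - post n \<le> (1 - \<P>(\<omega> in M. K \<omega> = 1)) / \<P>(\<omega> in M. K \<omega> = 1) * L n"
proof -
  interpret prob_space M using model unfolding dirichlet_label_model_def by blast
  have [measurable]: "K \<in> M \<rightarrow>\<^sub>M count_space UNIV" "\<And>i. y i \<in> M \<rightarrow>\<^sub>M count_space UNIV"
    and K1: "\<And>\<omega>. \<omega> \<in> space M \<Longrightarrow> K \<omega> \<ge> 1"
    using model unfolding dirichlet_label_model_def by auto
  define H where "H = {\<omega>\<in>space M. \<forall>i\<in>{1..n}. y i \<omega> = 1}"
  define E where "E k = {\<omega>\<in>space M. K \<omega> = k}" for k
  have sets [measurable]: "H \<in> sets M" "\<And>k. E k \<in> sets M"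
    unfolding H_def E_def by measurable
  have run: "prob (E k \<inter> H) = prob (E k) * (pochhammer (\<alpha> / real k) n / pochhammer \<alpha> n)" if "k \<ge> 1" for k
  proof -
    have "E k \<inter> H = {\<omega>\<in>space M. K \<omega> = k \<and> (\<forall>i\<in>{1..n}. y i \<omega> = 1)}"
      by (auto simp: E_def H_def)
    then show ?thesis
      using prob_constant_labels[OF \<alpha> model that, of n] by (simp add: E_def)
  qed
  have "pochhammer \<alpha> n > 0" using \<alpha> by (rule pochhammer_pos)
  \<comment> \<open>For \<open>k = 1\<close> the likelihood is 1, so the run contains the event
    \<open>K = 1\<close> up to a null set; this bounds \<open>prob H\<close> below uniformly in
    \<open>n\<close>.\<close>
  then have run1: "prob (E 1 \<inter> H) = prob (E 1)" using run[of 1] by simp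
  have "prob (E 1 \<inter> H) \<le> prob H" using sets by (intro finite_measure_mono) auto
  then have PH: "prob H \<ge> prob (E 1)" "prob (E 1) > 0"
    using pos unfolding run1 by (simp_all add: E_def)
  define Q where "Q = prob (H - E 1)"
  have "prob H = prob (E 1 \<inter> H) + Q"
    unfolding Q_def using sets by (subst finite_measure_Union[symmetric]) (auto intro!: arg_cong[where f = prob])
  moreover have "post n = prob (E 1 \<inter> H) / prob H"
    unfolding post_def cond_prob_def H_def E_def by (intro arg_cong2[where f = "(/)"] arg_cong[where f = prob]) auto
  ultimately have post: "1 - post n = Q / prob H"
    using PH by (simp add: field_simps)
  have Q0: "Q \<ge> 0" by (simp add: Q_def)
  have "prob (E 2) * L n = prob (E 2 \<inter> H)"
    using run[of 2] by (simp add: L_def)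
  also have "\<dots> \<le> Q"
    unfolding Q_def using sets by (intro finite_measure_mono) (auto simp: E_def)
  also have "\<dots> \<le> Q / prob H"
    using PH Q0 by (simp add: le_divide_eq_1 field_simps mult_left_le)
  finally show "\<P>(\<omega> in M. K \<omega> = 2) * L n \<le> 1 - post n"
    by (simp add: post E_def)
  \<comment> \<open>The shift by 2 enumerates the values of \<open>K\<close> other than 1. It is
    applied with \<open>B = H\<close> for the numerator and with the whole space for the prior
    mass.\<close>
  have tail: "(\<lambda>i. prob (E (i + 2) \<inter> B)) sums prob (B - E 1)" if "B \<in> sets M" for B
  proof -
    have "(\<Union>i. E (i + 2) \<inter> B) = B - E 1"
    proof (intro equalityI subsetI)
      fix \<omega> assume \<omega>: "\<omega> \<in> B - E 1"
      then have "\<omega> \<in> space M" using sets.sets_into_space[OF that] by auto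
      then have "\<omega> \<in> E ((K \<omega> - 2) + 2) \<inter> B" using K1[of \<omega>] \<omega> by (auto simp: E_def)
      then show "\<omega> \<in> (\<Union>i. E (i + 2) \<inter> B)" by blast
    qed (auto simp: E_def)
    moreover have "(\<lambda>i. prob (E (i + 2) \<inter> B)) sums prob (\<Union>i. E (i + 2) \<inter> B)"
      using that sets by (intro finite_measure_UNION) (auto simp: disjoint_family_on_def E_def)
    ultimately show ?thesis by simp
  qed
  have "Q \<le> (1 - prob (E 1)) * L n"
  proof (rule sums_le)
    show "(\<lambda>i. prob (E (i + 2) \<inter> H)) sums Q"
      unfolding Q_def using sets by (intro tail)
    have "E (i + 2) \<inter> space M = E (i + 2)" for i by (auto simp: E_def)
    then have "(\<lambda>i. prob (E (i + 2))) sums (1 - prob (E 1))"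
      using tail[of "space M"] sets by (simp add: prob_compl)
    then show "(\<lambda>i. prob (E (i + 2)) * L n) sums ((1 - prob (E 1)) * L n)"
      by (rule sums_mult2)
    fix i :: nat
    have "pochhammer (\<alpha> / real (i + 2)) n \<le> pochhammer (\<alpha> / 2) n"
      using \<alpha> by (intro pochhammer_mono divide_left_mono) auto
    then show "prob (E (i + 2) \<inter> H) \<le> prob (E (i + 2)) * L n"
      using run[of "i + 2"] \<open>pochhammer \<alpha> n > 0\<close> unfolding L_def
      by (auto intro!: mult_left_mono divide_right_mono)
  qed
  then have "Q / prob H \<le> (1 - prob (E 1)) * L n / prob (E 1)"
    using PH Q0 by (intro frac_le) auto
  then show "1 - post n \<le> (1 - \<P>(\<omega> in M. K \<omega> = 1)) / \<P>(\<omega> in M. K \<omega> = 1) * L n"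
    by (simp add: post E_def)
qed

section \<open>Explicit posterior bounds and the rate of convergence\<close>

theorem theorem5p7:
  fixes M :: "'a measure" and \<alpha> :: real and K :: "'a \<Rightarrow> nat"
    and s :: "nat \<Rightarrow> 'a \<Rightarrow> real" and y :: "nat \<Rightarrow> 'a \<Rightarrow> nat"
    and \<pi> :: "nat \<Rightarrow> real" and post :: "nat \<Rightarrow> real"
  assumes "\<alpha> > 0"
    and "dirichlet_label_model M \<alpha> K s y"
    and "\<And>k. \<pi> k = \<P>(\<omega> in M. K \<omega> = k)"
    and "\<pi> 1 > 0" and "\<pi> 2 > 0"
    and "\<And>n. post n = \<P>(\<omega> in M. K \<omega> = 1 \<bar> \<forall>i\<in>{1..n}. y i \<omega> = 1)"
  shows "(\<forall>n\<ge>1.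
            \<pi> 2 / 2 * ((\<alpha> / 2) / (real n - 1 + \<alpha> / 2)) powr (\<alpha> / 2) \<le> 1 - post n \<and>
            1 - post n \<le> (1 - \<pi> 1) / \<pi> 1 * (1 / 2) * ((1 + \<alpha>) / (real n + \<alpha>)) powr (\<alpha> / 2)) \<and>
         (\<lambda>n. 1 - post n) \<in> \<Theta>(\<lambda>n. real n powr (- \<alpha> / 2)) \<and>
         post \<longlonglongrightarrow> 1"
proof -
  interpret prob_space M using assms(2) unfolding dirichlet_label_model_def by blast
  define lo where "lo n = \<pi> 2 / 2 * ((\<alpha> / 2) / (real n - 1 + \<alpha> / 2)) powr (\<alpha> / 2)" for n :: nat
  define c where "c = (1 - \<pi> 1) / \<pi> 1 * (1 / 2)"
  define hi where "hi n = ((1 + \<alpha>) / (real n + \<alpha>)) powr (\<alpha> / 2)" for n :: nat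
  have "\<pi> 1 \<le> 1" by (simp add: assms(3))
  then have ratio: "(1 - \<pi> 1) / \<pi> 1 \<ge> 0" using assms(4) by simp
  have bounds: "lo n \<le> 1 - post n" "1 - post n \<le> c * hi n" if "n \<ge> 1" for n
  proof -
    let ?L = "pochhammer (\<alpha> / 2) n / pochhammer \<alpha> n"
    note post = posterior_complement_bounds[OF assms(1,2), of n, folded assms(3) assms(6), OF assms(4)]
    \<comment> \<open>Both ratio bounds are taken at \<open>a = \<alpha> / 2\<close>, so that
      \<open>2 * a\<close> is \<open>\<alpha>\<close>.\<close>
    have "lo n \<le> \<pi> 2 * ?L"
      using mult_left_mono[OF pochhammer_half_ratio_ge[of "\<alpha> / 2" n], of "\<pi> 2"] assms(1,5) that
      by (simp add: lo_def)
    with post(1) show "lo n \<le> 1 - post n" by linarith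
    have "(1 - \<pi> 1) / \<pi> 1 * ?L \<le> c * hi n"
      using mult_left_mono[OF pochhammer_half_ratio_le[of "\<alpha> / 2" n], of "(1 - \<pi> 1) / \<pi> 1"] assms(1) ratio that
      by (simp add: c_def hi_def)
    with post(2) show "1 - post n \<le> c * hi n" by linarith
  qed
  have lo_pos: "lo n > 0" if "n \<ge> 1" for n
    using assms(1,5) that unfolding lo_def by (intro mult_pos_pos) (auto simp: add_nonneg_pos)
  have lo_Theta: "lo \<in> \<Theta>(\<lambda>n. real n powr (- \<alpha> / 2))"
    using assms(1,5) unfolding lo_def by real_asymp
  have hi_Theta: "hi \<in> \<Theta>(\<lambda>n. real n powr (- \<alpha> / 2))"
    using assms(1) unfolding hi_def by real_asymp
  have hi_0: "hi \<longlonglongrightarrow> 0"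
    using assms(1) unfolding hi_def by real_asymp
  have "(\<lambda>n. 1 - post n) \<in> O(hi)"
  proof (rule bigoI[of _ c])
    show "\<forall>\<^sub>F n in sequentially. norm (1 - post n) \<le> c * norm (hi n)"
      using eventually_ge_at_top[of 1]
    proof eventually_elim
      case (elim n)
      then show ?case using bounds[of n] lo_pos[of n] by (simp add: hi_def)
    qed
  qed
  moreover have "lo \<in> O(\<lambda>n. 1 - post n)"
  proof (rule bigoI[of _ 1])
    show "\<forall>\<^sub>F n in sequentially. norm (lo n) \<le> 1 * norm (1 - post n)"
      using eventually_ge_at_top[of 1]
    proof eventually_elim
      case (elim n)
      then show ?case using bounds[of n] lo_pos[of n] by simp
    qed
  qed
  \<comment> \<open>Both \<open>lo\<close> and \<open>hi\<close> have exact order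
    \<open>n powr (- \<alpha> / 2)\<close>, hence so does the quantity between \<open>lo\<close> and
    a multiple of \<open>hi\<close>.\<close>
  ultimately have Theta: "(\<lambda>n. 1 - post n) \<in> \<Theta>(\<lambda>n. real n powr (- \<alpha> / 2))"
    using lo_Theta hi_Theta
    by (meson bigthetaI bigthetaD1 bigthetaD2 bigomega_iff_bigo landau_o.big_trans)
  have "(\<lambda>n. 1 - post n) \<longlonglongrightarrow> 0"
  proof (rule tendsto_sandwich[of "\<lambda>_. 0"])
    show "\<forall>\<^sub>F n in sequentially. 0 \<le> 1 - post n"
      using eventually_ge_at_top[of 1]
      by eventually_elim (use bounds(1) lo_pos in \<open>force intro: less_imp_le less_le_trans\<close>)
    show "\<forall>\<^sub>F n in sequentially. 1 - post n \<le> c * hi n"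
      using eventually_ge_at_top[of 1] by eventually_elim (rule bounds)
    show "(\<lambda>n. c * hi n) \<longlonglongrightarrow> 0" using tendsto_mult_left[OF hi_0, of c] by simp
  qed auto
  from tendsto_diff[OF tendsto_const[of 1] this] have "post \<longlonglongrightarrow> 1" by simp
  with bounds Theta show ?thesis unfolding lo_def c_def hi_def by blast
qed

end
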